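(* Consider the problems CC-OPF and CC-OPF-2 defined in the context, where the random vector $\omega$ has a Gaussian mixture distribution. Then CC-OPF-2 is a safe approximation of CC-OPF: if $(\overline p,\theta,\alpha)$, together with some values of the auxiliary variables, is feasible for CC-OPF-2, then $(\overline p,\theta,\alpha)$ is feasible for CC-OPF.
   Context: **Network data.** $\mathcal V$ is the finite set of buses, $\mathcal G\subseteq\mathcal V$ the set of buses with a generator, and $\mathcal B$ the set of (undirected) branches. $\beta_{ij}=\beta_{ji}$ is the susceptance and $f^{\max}_{ij}$ the line limit of branch $(i,j)$; $d\in\mathbb R^{\mathcal V}$ are the demands; $\mu\in\mathbb R^{\mathcal V}$ are the nominal wind outputs; $p_i^{\min},p_i^{\max}$ are the generation bounds for $i\in\mathcal G$; $c^i(x)=c^i_1x^2+c^i_2x$ is the generation cost; $\epsilon\in(0,1)$ is the risk parameter; $e$ is the all-ones vector. The matrix $B\in\mathbb R^{\mathcal V\times\mathcal V}$ is the weighted Laplacian: $B_{ij}=-\beta_{ij}$ if $(i,j)\in\mathcal B$, $B_{jj}=\sum_{k:(k,j)\in\mathcal B}\beta_{kj}$, and $B_{ij}=0$ otherwise. $\widehat B$ is $B$ with the last row and column removed (assumed invertible), and $\breve B=\begin{bmatrix}\widehat B^{-1}&0\\0&0\end{bmatrix}$. For a vector $w$, $[w]_i$ is its $i$-th entry. **Uncertainty.** $\omega\in\mathbb R^{\mathcal V}$ is a random vector with $\mathbb E(\omega)=0$ and covariance $\Sigma$, whose density is a Gaussian mixture $\sum_{j\in\mathcal J}\pi_j\,p^{\mathcal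 N}(\cdot\mid\nu_j,\Sigma_j)$, where $\mathcal J$ is finite, $\pi_j\ge0$, $\sum_j\pi_j=1$, and $p^{\mathcal N}(\cdot\mid\nu_j,\Sigma_j)$ is the density of the Gaussian with mean $\nu_j$ and covariance $\Sigma_j$. **CC-OPF.** The variables are $\overline p,\theta,\alpha\in\mathbb R^{\mathcal V}$ (with $\overline p_i=\alpha_i=0$ for $i\notin\mathcal G$). Minimize $\mathbb E_\omega\big(\sum_{i\in\mathcal G}c^i(\overline p_i-\alpha_i(e^\intercal\omega))\big)$ subject to (1) $\sum_{i\in\mathcal G}\alpha_i=1$; (2) $\sum_{i\in\mathcal V}(\overline p_i+\mu_i-d_i)=0$; (3) $B\theta=\overline p+\mu-d$; (4) for all $(i,j)\in\mathcal B$: $\mathbb P\big(\beta_{ij}(\theta_i-\theta_j+[\breve B(\omega-(e^\intercal\omega)\alpha)]_i-[\breve B(\omega-(e^\intercal\omega)\alpha)]_j)\le f^{\max}_{ij}\big)\ge1-\epsilon$; (5) for all $(i,j)\in\mathcal B$: $\mathbb P\big(\beta_{ij}(\theta_i-\theta_j+[\breve B(\omega-(e^\intercal\omega)\alpha)]_i-[\breve B(\omega-(e^\intercal\omega)\alpha)]_j)\ge -f^{\max}_{ij}\big)\ge1-\epsilon$; (6) for all $i\in\mathcal G$: $\mathbb P(\overline p_i-(e^\intercal\omega)\alpha_i\ge p_i^{\min})\ge1-\epsilon$; (7) for all $i\in\mathcal G$: $\mathbb P(\overline p_i-(e^\intercal\omega)\alpha_i\le p_i^{\max})\ge1-\epsilon$.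 Let $\mathcal M$ index all the individual chance constraints in (4)–(7). With $x=(\overline p,\theta,\alpha)$, constraint $m\in\mathcal M$ has the form $\mathbb P(a_m(x)^\intercal\omega\le b_m(x))\ge1-\epsilon$. Explicitly, writing $\breve B_i$ for the $i$-th row of $\breve B$ and $I$ for the identity matrix: for (4), $a_m(x)^\intercal=\beta_{ij}(\breve B_i-\breve B_j)(I-\alpha e^\intercal)$ and $b_m(x)=f^{\max}_{ij}-\beta_{ij}(\theta_i-\theta_j)$; for (5), $a_m(x)^\intercal=-\beta_{ij}(\breve B_i-\breve B_j)(I-\alpha e^\intercal)$ and $b_m(x)=f^{\max}_{ij}+\beta_{ij}(\theta_i-\theta_j)$; for (6), $a_m(x)=\alpha_ie$ and $b_m(x)=\overline p_i-p_i^{\min}$; for (7), $a_m(x)=-\alpha_ie$ and $b_m(x)=p_i^{\max}-\overline p_i$. **CC-OPF-2.** Fix $0\le s^{\min}<s^{\max}$, real numbers $t_{\min},t_{\max}$ (lower and upper bounds for the variables $t$ below), and $\mathcal L=\{LB,LB+1,\dots,-1\}$, with $LB$ a negative integer ($LB=-\infty$, i.e. all negative integers, is also allowed). Fix breakpoints $s^{\min}=x_0<\dots<x_N=s^{\max}$ and, for $n\in\mathcal N=\{1,\dots,N\}$, let $s\mapsto\lambda_{1,n}s+\lambda_{2,n}$ be the affine function through $(x_{n-1},\Phi(x_{n-1}))$ and $(x_n,\Phi(x_n))$, where $\Phi$ is the standard normal cumulative distribution function. Minimize $\sum_{i\in\mathcal G}\big(c_1^i\overline p_i^2+c_2^i\overline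 p_i+c_1^i\alpha_i^2\,e^\intercal\Sigma e\big)$ subject to (1), (3), and, for each $m\in\mathcal M$, with auxiliary variables $y_j,s_j,t_j,v_j,\breve{BL}_j\in\mathbb R$ ($j\in\mathcal J$), $\breve{bl}_{j,l}\in\mathbb R$ and $z_{j,l}\in\{0,1\}$ ($j\in\mathcal J$, $l\in\mathcal L$), all depending also on $m$, writing $a=a_m$, $b=b_m$: - $\sum_{j\in\mathcal J}\pi_jy_j\ge1-\epsilon$, and $y_j\ge0.5$ for all $j\in\mathcal J$; - $\sqrt{a(x)^\intercal\Sigma_ja(x)}\le t_j$ for all $j\in\mathcal J$; - $\min\{\lambda_{1,n}s_j+\lambda_{2,n}:n\in\mathcal N\}\ge y_j$ for all $j\in\mathcal J$; - $s_j=(s^{\max}-s^{\min})v_j+s^{\min}$ and $v_j=\sum_{l\in\mathcal L}2^lz_{j,l}$ for all $j\in\mathcal J$; - $\breve{BL}_j=\sum_{l\in\mathcal L}2^l\,\breve{bl}_{j,l}$ for all $j\in\mathcal J$; - $t_{\min}z_{j,l}\le\breve{bl}_{j,l}\le t_{\max}z_{j,l}$ for all $j\in\mathcal J$, $l\in\mathcal L$; - $-t_{\max}(1-z_{j,l})\le\breve{bl}_{j,l}-t_j\le t_{\max}(1-z_{j,l})$ for all $j\in\mathcal J$, $l\in\mathcal L$; - $(s^{\max}-s^{\min})\breve{BL}_j+s^{\min}t_j+\nu_j^\intercal a(x)\le b(x)$ for all $j\in\mathcal J$. *)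

theory Defs
  imports "HOL-Probability.Probability"
begin

record 'x minimization_problem =
  objective :: "'x \<Rightarrow> real"
  feasible :: "'x set"

section \<open>Network data\<close>

text \<open>The buses are the elements of the finite type \<open>'v\<close>. Undirected branches are represented by
  a symmetric irreflexive set of ordered pairs, so both orientations of a branch belong to it.
  The bus enumerated last is called \<open>last_bus\<close>; no other part of the enumeration matters.\<close>

record ('v::finite) network =
  gens :: "'v set"
  branches :: "('v \<times> 'v) set"
  susc :: "'v \<Rightarrow> 'v \<Rightarrow> real"
  fmax :: "'v \<Rightarrow> 'v \<Rightarrow> real"
  demand :: "real^'v"
  wind :: "real^'v"
  pmin :: "'v \<Rightarrow> real"
  pmax :: "'v \<Rightarrow> real"
  cost1 :: "'v \<Rightarrow> real"
  cost2 :: "'v \<Rightarrow> real"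
  risk :: real
  last_bus :: 'v

definition gen_cost :: "('v::finite) network \<Rightarrow> 'v \<Rightarrow> real \<Rightarrow> real" where
  "gen_cost net i u = cost1 net i * u\<^sup>2 + cost2 net i * u"

definition laplacian :: "('v::finite) network \<Rightarrow> real^'v^'v" where
  "laplacian net = (\<chi> i j.
     if i = j then (\<Sum>k | (k, j) \<in> branches net. susc net k j)
     else if (i, j) \<in> branches net then - susc net i j
     else 0)"

text \<open>\<open>submatrix_inverse S A C\<close>: the principal submatrix of \<open>C\<close> with index set \<open>S\<close> is the
  two-sided inverse of the principal submatrix of \<open>A\<close> with index set \<open>S\<close>.\<close>

definition submatrix_inverse :: "('v::finite) set \<Rightarrow> real^'v^'v \<Rightarrow> real^'v^'v \<Rightarrow> bool" where
  "submatrix_inverse S A C \<longleftrightarrow> (\<forall>i\<in>S. \<forall>j\<in>S.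
     (\<Sum>k\<in>S. A $ i $ k * C $ k $ j) = (if i = j then 1 else 0) \<and>
     (\<Sum>k\<in>S. C $ i $ k * A $ k $ j) = (if i = j then 1 else 0))"

text \<open>The block matrix with the inverse of the reduced Laplacian in the upper left corner and
  zeros in the last row and column.\<close>

definition Bbreve :: "('v::finite) network \<Rightarrow> real^'v^'v" where
  "Bbreve net = (THE C. submatrix_inverse (- {last_bus net}) (laplacian net) C \<and>
     (\<forall>i j. i = last_bus net \<or> j = last_bus net \<longrightarrow> C $ i $ j = 0))"

definition valid_network :: "('v::finite) network \<Rightarrow> bool" where
  "valid_network net \<longleftrightarrow>
     sym (branches net) \<and> irrefl (branches net) \<and>
     (\<forall>(i, j)\<in>branches net. susc net i j = susc net j i \<and> fmax net i j = fmax net j i) \<and>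
     (\<exists>C. submatrix_inverse (- {last_bus net}) (laplacian net) C) \<and>
     0 < risk net \<and> risk net < 1"

lemma Bbreve_spec:
  assumes "valid_network net"
  shows "submatrix_inverse (- {last_bus net}) (laplacian net) (Bbreve net)"
    and "i = last_bus net \<or> j = last_bus net \<Longrightarrow> Bbreve net $ i $ j = 0"
proof -
  let ?S = "- {last_bus net}" and ?A = "laplacian net"
  let ?P = "\<lambda>C. submatrix_inverse ?S ?A C \<and>
     (\<forall>i j. i = last_bus net \<or> j = last_bus net \<longrightarrow> C $ i $ j = 0)"
  obtain C0 where C0: "submatrix_inverse ?S ?A C0"
    using assms unfolding valid_network_def by blast
  define C1 :: "real^'a^'a" where "C1 = (\<chi> i j. if i \<in> ?S \<and> j \<in> ?S then C0 $ i $ j else 0)"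
  have "?P C1"
    using C0 unfolding submatrix_inverse_def C1_def by simp
  moreover have "C = D" if C: "?P C" and D: "?P D" for C D
  proof -
    have "C $ i $ j = D $ i $ j" if "i \<in> ?S" "j \<in> ?S" for i j
    proof -
      have "C $ i $ j = (\<Sum>k\<in>?S. C $ i $ k * (if k = j then 1 else 0))"
        using that by (subst sum.remove[of _ j]) (auto intro!: sum.neutral)
      also have "\<dots> = (\<Sum>k\<in>?S. C $ i $ k * (\<Sum>l\<in>?S. ?A $ k $ l * D $ l $ j))"
        using D that unfolding submatrix_inverse_def by (intro sum.cong) auto
      also have "\<dots> = (\<Sum>l\<in>?S. (\<Sum>k\<in>?S. C $ i $ k * ?A $ k $ l) * D $ l $ j)"
        unfolding sum_distrib_left sum_distrib_right
        by (subst sum.swap) (simp add: mult.assoc)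
      also have "\<dots> = (\<Sum>l\<in>?S. (if i = l then 1 else 0) * D $ l $ j)"
        using C that unfolding submatrix_inverse_def by (intro sum.cong) auto
      also have "\<dots> = D $ i $ j"
        using that by (subst sum.remove[of _ i]) (auto intro!: sum.neutral)
      finally show ?thesis .
    qed
    then show "C = D" using C D by (metis (no_types, lifting) ComplI singletonD vec_eq_iff)
  qed
  ultimately have "?P (Bbreve net)"
    unfolding Bbreve_def by (intro theI[of ?P C1]) blast+
  then show "submatrix_inverse ?S ?A (Bbreve net)"
    and "i = last_bus net \<or> j = last_bus net \<Longrightarrow> Bbreve net $ i $ j = 0" by blast+
qed

section \<open>Uncertainty\<close>

definition sym_pos_def :: "real^'n^'n \<Rightarrow> bool" where
  "sym_pos_def S \<longleftrightarrow> transpose S = S \<and> (\<forall>x. x \<noteq> 0 \<longrightarrow> 0 < x \<bullet> (S *v x))"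

definition mvn_density :: "real^'n \<Rightarrow> real^'n^'n \<Rightarrow> real^'n \<Rightarrow> real" where
  "mvn_density nu S x =
     exp (- ((x - nu) \<bullet> (matrix_inv S *v (x - nu))) / 2) / sqrt ((2 * pi) ^ CARD('n) * det S)"

record ('v::finite, 'j) mixture =
  comps :: "'j set"
  weight :: "'j \<Rightarrow> real"
  cmean :: "'j \<Rightarrow> real^'v"
  ccov :: "'j \<Rightarrow> real^'v^'v"

text \<open>Positive definiteness of the component covariances is what makes the component densities
  meaningful.\<close>

definition valid_mixture :: "('v::finite, 'j) mixture \<Rightarrow> bool" where
  "valid_mixture mix \<longleftrightarrow> finite (comps mix) \<and>
     (\<forall>j\<in>comps mix. 0 \<le> weight mix j \<and> sym_pos_def (ccov mix j)) \<and>
     (\<Sum>j\<in>comps mix. weight mix j) = 1"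

definition mixture_density :: "('v::finite, 'j) mixture \<Rightarrow> real^'v \<Rightarrow> real" where
  "mixture_density mix x =
     (\<Sum>j\<in>comps mix. weight mix j * mvn_density (cmean mix j) (ccov mix j) x)"

definition covariance_matrix :: "'a measure \<Rightarrow> ('a \<Rightarrow> real^'v) \<Rightarrow> real^'v^'v" where
  "covariance_matrix M X = (\<chi> i j. LINT \<xi>|M.
     (X \<xi> $ i - (LINT \<eta>|M. X \<eta> $ i)) * (X \<xi> $ j - (LINT \<eta>|M. X \<eta> $ j)))"

section \<open>CC-OPF\<close>

type_synonym 'v decision = "(real^'v) \<times> (real^'v) \<times> (real^'v)"

abbreviation ones :: "real^'v" where "ones \<equiv> 1"

definition decision_domain :: "('v::finite) network \<Rightarrow> 'v decision set" where
  "decision_domain net = {(p, \<theta>, \<alpha>). \<forall>i. i \<notin> gens net \<longrightarrow> p $ i = 0 \<and> \<alpha> $ i = 0}"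

definition participation :: "('v::finite) network \<Rightarrow> 'v decision \<Rightarrow> bool" where
  "participation net = (\<lambda>(p, \<theta>, \<alpha>). (\<Sum>i\<in>gens net. \<alpha> $ i) = 1)"

definition power_balance :: "('v::finite) network \<Rightarrow> 'v decision \<Rightarrow> bool" where
  "power_balance net = (\<lambda>(p, \<theta>, \<alpha>). (\<Sum>i\<in>UNIV. p $ i + wind net $ i - demand net $ i) = 0)"

definition dc_flow :: "('v::finite) network \<Rightarrow> 'v decision \<Rightarrow> bool" where
  "dc_flow net = (\<lambda>(p, \<theta>, \<alpha>). laplacian net *v \<theta> = p + wind net - demand net)"

definition line_flow :: "('v::finite) network \<Rightarrow> 'v decision \<Rightarrow> 'v \<Rightarrow> 'v \<Rightarrow> real^'v \<Rightarrow> real" where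
  "line_flow net = (\<lambda>(p, \<theta>, \<alpha>) i j w.
     susc net i j * (\<theta> $ i - \<theta> $ j
       + (Bbreve net *v (w - (ones \<bullet> w) *\<^sub>R \<alpha>)) $ i
       - (Bbreve net *v (w - (ones \<bullet> w) *\<^sub>R \<alpha>)) $ j))"

definition gen_output :: "'v decision \<Rightarrow> 'v \<Rightarrow> real^'v \<Rightarrow> real" where
  "gen_output = (\<lambda>(p, \<theta>, \<alpha>) i w. p $ i - (ones \<bullet> w) * \<alpha> $ i)"

definition cc_opf ::
  "('v::finite) network \<Rightarrow> 'a measure \<Rightarrow> ('a \<Rightarrow> real^'v) \<Rightarrow> 'v decision minimization_problem" where
  "cc_opf net M \<omega> = \<lparr>
     objective = (\<lambda>x. LINT \<xi>|M. (\<Sum>i\<in>gens net. gen_cost net i (gen_output x i (\<omega> \<xi>)))),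
     feasible = {x \<in> decision_domain net.
       participation net x \<and> power_balance net x \<and> dc_flow net x \<and>
       (\<forall>(i, j)\<in>branches net.
          \<P>(\<xi> in M. line_flow net x i j (\<omega> \<xi>) \<le> fmax net i j) \<ge> 1 - risk net) \<and>
       (\<forall>(i, j)\<in>branches net.
          \<P>(\<xi> in M. line_flow net x i j (\<omega> \<xi>) \<ge> - fmax net i j) \<ge> 1 - risk net) \<and>
       (\<forall>i\<in>gens net. \<P>(\<xi> in M. gen_output x i (\<omega> \<xi>) \<ge> pmin net i) \<ge> 1 - risk net) \<and>
       (\<forall>i\<in>gens net. \<P>(\<xi> in M. gen_output x i (\<omega> \<xi>) \<le> pmax net i) \<ge> 1 - risk net)}\<rparr>"

section \<open>CC-OPF-2\<close>

datatype 'v chance_index = Line_Upper 'v 'v | Line_Lower 'v 'v | Gen_Lower 'v | Gen_Upper 'v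

definition chance_indices :: "('v::finite) network \<Rightarrow> 'v chance_index set" where
  "chance_indices net =
     (\<lambda>(i, j). Line_Upper i j) ` branches net \<union> (\<lambda>(i, j). Line_Lower i j) ` branches net \<union>
     Gen_Lower ` gens net \<union> Gen_Upper ` gens net"

text \<open>\<open>(\<chi> k l. \<alpha> $ k * ones $ l)\<close> is the rank-one matrix formed from the column \<open>\<alpha>\<close> and the
  all-ones row.\<close>

fun a_vec :: "('v::finite) network \<Rightarrow> 'v decision \<Rightarrow> 'v chance_index \<Rightarrow> real^'v" where
  "a_vec net (p, \<theta>, \<alpha>) (Line_Upper i j) =
     (susc net i j *\<^sub>R (row i (Bbreve net) - row j (Bbreve net)))
       v* (mat 1 - (\<chi> k l. \<alpha> $ k * ones $ l))"
| "a_vec net (p, \<theta>, \<alpha>) (Line_Lower i j) =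
     (- susc net i j *\<^sub>R (row i (Bbreve net) - row j (Bbreve net)))
       v* (mat 1 - (\<chi> k l. \<alpha> $ k * ones $ l))"
| "a_vec net (p, \<theta>, \<alpha>) (Gen_Lower i) = \<alpha> $ i *\<^sub>R ones"
| "a_vec net (p, \<theta>, \<alpha>) (Gen_Upper i) = - \<alpha> $ i *\<^sub>R ones"

fun b_val :: "('v::finite) network \<Rightarrow> 'v decision \<Rightarrow> 'v chance_index \<Rightarrow> real" where
  "b_val net (p, \<theta>, \<alpha>) (Line_Upper i j) = fmax net i j - susc net i j * (\<theta> $ i - \<theta> $ j)"
| "b_val net (p, \<theta>, \<alpha>) (Line_Lower i j) = fmax net i j + susc net i j * (\<theta> $ i - \<theta> $ j)"
| "b_val net (p, \<theta>, \<alpha>) (Gen_Lower i) = p $ i - pmin net i"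
| "b_val net (p, \<theta>, \<alpha>) (Gen_Upper i) = pmax net i - p $ i"

definition Phi :: "real \<Rightarrow> real" where
  "Phi = cdf std_normal_distribution"

record approx_data =
  smin :: real
  smax :: real
  tmin :: real
  tmax :: real
  levels :: "int set"
  npieces :: nat
  breakpoint :: "nat \<Rightarrow> real"
  slope :: "nat \<Rightarrow> real"
  intercept :: "nat \<Rightarrow> real"

definition valid_approx :: "approx_data \<Rightarrow> bool" where
  "valid_approx D \<longleftrightarrow>
     0 \<le> smin D \<and> smin D < smax D \<and>
     ((\<exists>LB<0. levels D = {LB..-1}) \<or> levels D = {..-1}) \<and>
     breakpoint D 0 = smin D \<and> breakpoint D (npieces D) = smax D \<and>
     (\<forall>n\<in>{1..npieces D}.
        breakpoint D (n - 1) < breakpoint D n \<and>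
        slope D n * breakpoint D (n - 1) + intercept D n = Phi (breakpoint D (n - 1)) \<and>
        slope D n * breakpoint D n + intercept D n = Phi (breakpoint D n))"

text \<open>The auxiliary variables, indexed by mixture component and, where needed, level; there is one
  such family for every chance constraint.\<close>

record 'j aux_vars =
  yv :: "'j \<Rightarrow> real"
  sv :: "'j \<Rightarrow> real"
  tv :: "'j \<Rightarrow> real"
  vv :: "'j \<Rightarrow> real"
  BLv :: "'j \<Rightarrow> real"
  blv :: "'j \<Rightarrow> int \<Rightarrow> real"
  zv :: "'j \<Rightarrow> int \<Rightarrow> real"

text \<open>For a finite set of levels \<open>has_sum\<close> is an equation with the ordinary finite sum; for the
  infinite one it also states convergence.\<close>

definition approx_chance ::
  "approx_data \<Rightarrow> ('v::finite, 'j) mixture \<Rightarrow> real \<Rightarrow> real^'v \<Rightarrow> real \<Rightarrow> 'j aux_vars \<Rightarrow> bool" where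
  "approx_chance D mix eps a b u \<longleftrightarrow>
     (\<Sum>j\<in>comps mix. weight mix j * yv u j) \<ge> 1 - eps \<and>
     (\<forall>j\<in>comps mix.
        yv u j \<ge> 0.5 \<and>
        sqrt (a \<bullet> (ccov mix j *v a)) \<le> tv u j \<and>
        Min ((\<lambda>n. slope D n * sv u j + intercept D n) ` {1..npieces D}) \<ge> yv u j \<and>
        sv u j = (smax D - smin D) * vv u j + smin D \<and>
        ((\<lambda>l. 2 powi l * zv u j l) has_sum vv u j) (levels D) \<and>
        ((\<lambda>l. 2 powi l * blv u j l) has_sum BLv u j) (levels D) \<and>
        (\<forall>l\<in>levels D.
           zv u j l \<in> {0, 1} \<and>
           tmin D * zv u j l \<le> blv u j l \<and> blv u j l \<le> tmax D * zv u j l \<and>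
           - tmax D * (1 - zv u j l) \<le> blv u j l - tv u j \<and>
           blv u j l - tv u j \<le> tmax D * (1 - zv u j l)) \<and>
        (smax D - smin D) * BLv u j + smin D * tv u j + cmean mix j \<bullet> a \<le> b)"

definition cc_opf_2 ::
  "('v::finite) network \<Rightarrow> ('v, 'j) mixture \<Rightarrow> real^'v^'v \<Rightarrow> approx_data \<Rightarrow>
   ('v decision \<times> ('v chance_index \<Rightarrow> 'j aux_vars)) minimization_problem" where
  "cc_opf_2 net mix Cov D = \<lparr>
     objective = (\<lambda>((p, \<theta>, \<alpha>), u). \<Sum>i\<in>gens net.
       cost1 net i * (p $ i)\<^sup>2 + cost2 net i * p $ i
         + cost1 net i * (\<alpha> $ i)\<^sup>2 * (ones \<bullet> (Cov *v ones))),
     feasible = {(x, u). x \<in> decision_domain net \<and>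
       participation net x \<and> dc_flow net x \<and>
       (\<forall>m\<in>chance_indices net.
          approx_chance D mix (risk net) (a_vec net x m) (b_val net x m) (u m))}\<rparr>"

end

theory Submission
  imports Defs
begin

text \<open>For \<open>a \<noteq> 0\<close> the probability of \<open>a \<bullet> \<omega> \<le> b\<close> is \<open>\<Sum>j. \<pi>\<^sub>j \<Phi>((b - \<nu>\<^sub>j \<bullet> a) / \<sigma>\<^sub>j)\<close> with
  \<open>\<sigma>\<^sub>j\<^sup>2 = a \<bullet> \<Sigma>\<^sub>j a\<close>. Each term is computed in a \<open>\<Sigma>\<^sub>j\<close>-orthonormal basis whose first vector is
  \<open>a / \<sigma>\<^sub>j\<close>: there the density becomes a product of standard normal densities and the half-space a
  condition on one coordinate. The binary constraints force \<open>BL\<^sub>j = v\<^sub>j t\<^sub>j\<close>, so the last constraint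
  reads \<open>s\<^sub>j t\<^sub>j \<le> b - \<nu>\<^sub>j \<bullet> a\<close>; as \<open>s\<^sub>j \<ge> 0\<close> and \<open>t\<^sub>j \<ge> \<sigma>\<^sub>j\<close>, the \<open>j\<close>-th term is at least
  \<open>\<Phi>(s\<^sub>j)\<close>. By concavity of \<open>\<Phi>\<close> on the nonnegative reals its chords lie below it, so
  \<open>\<Phi>(s\<^sub>j) \<ge> y\<^sub>j\<close>. The balance equation (2) follows from (3) because the columns of the Laplacian sum
  to zero.\<close>

section \<open>Linear change of variables\<close>

lemma prod_Basis_cart:
  "(\<Prod>b\<in>(Basis :: (real^'n) set). f b) = (\<Prod>i\<in>UNIV. f (axis i 1))"
proof -
  have "bij_betw (\<lambda>i. axis i 1) (UNIV :: 'n set) (Basis :: (real^'n) set)"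
    by (auto simp: bij_betw_def Basis_vec_def inj_def axis_eq_axis)
  from prod.reindex_bij_betw[OF this, of f] show ?thesis by simp
qed

text \<open>By Fubini the coordinate along \<open>e\<close> can be integrated innermost. On each
  line parallel to \<open>e\<close> the function \<open>h\<close> is constant, so the map is a
  translation there and leaves the inner integral unchanged.\<close>

lemma nn_integral_lborel_shear:
  fixes f :: "'a::euclidean_space \<Rightarrow> ennreal" and h :: "'a \<Rightarrow> real"
  assumes e: "e \<in> Basis" and [measurable]: "f \<in> borel_measurable borel" "h \<in> borel_measurable borel"
    and h: "\<And>x s. h (x + s *\<^sub>R e) = h x"
  shows "(\<integral>\<^sup>+x. f (x + h x *\<^sub>R e) \<partial>lborel) = (\<integral>\<^sup>+x. f x \<partial>lborel)"
proof -
  interpret product_sigma_finite "\<lambda>b::'a. lborel :: real measure" ..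
  let ?B = "Basis - {e}"
  have B: "Basis = insert e ?B" using e by auto
  have Fubini: "(\<integral>\<^sup>+x. g x \<partial>lborel) =
      (\<integral>\<^sup>+x. (\<integral>\<^sup>+y. g ((\<Sum>b\<in>?B. x b *\<^sub>R b) + y *\<^sub>R e) \<partial>lborel) \<partial>(\<Pi>\<^sub>M b\<in>?B. lborel))"
    if [measurable]: "g \<in> borel_measurable borel" for g :: "'a \<Rightarrow> ennreal"
  proof -
    have "(\<integral>\<^sup>+x. g x \<partial>lborel) = (\<integral>\<^sup>+x. g (\<Sum>b\<in>Basis. x b *\<^sub>R b) \<partial>(\<Pi>\<^sub>M b\<in>Basis. lborel))"
      by (subst lborel_eq) (simp add: nn_integral_distr)
    also have "\<dots> = (\<integral>\<^sup>+x. g (\<Sum>b\<in>insert e ?B. x b *\<^sub>R b) \<partial>(\<Pi>\<^sub>M b\<in>insert e ?B. lborel))"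
      using B by simp
    also have "\<dots> = (\<integral>\<^sup>+x. (\<integral>\<^sup>+y. g (\<Sum>b\<in>insert e ?B. (x(e := y)) b *\<^sub>R b) \<partial>lborel) \<partial>(\<Pi>\<^sub>M b\<in>?B. lborel))"
      by (rule product_nn_integral_insert) (simp_all del: insert_Diff_single)
    also have "\<dots> = (\<integral>\<^sup>+x. (\<integral>\<^sup>+y. g ((\<Sum>b\<in>?B. x b *\<^sub>R b) + y *\<^sub>R e) \<partial>lborel) \<partial>(\<Pi>\<^sub>M b\<in>?B. lborel))"
    proof (intro nn_integral_cong arg_cong[where f = g])
      fix x :: "'a \<Rightarrow> real" and y :: real
      have "(\<Sum>b\<in>?B. (x(e := y)) b *\<^sub>R b) = (\<Sum>b\<in>?B. x b *\<^sub>R b)"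
        by (intro sum.cong) auto
      then show "(\<Sum>b\<in>insert e ?B. (x(e := y)) b *\<^sub>R b) = (\<Sum>b\<in>?B. x b *\<^sub>R b) + y *\<^sub>R e"
        by (simp add: add.commute del: insert_Diff_single)
    qed
    finally show ?thesis .
  qed
  \<comment> \<open>The inner integral is shifted by the constant \<open>h c\<close>.\<close>
  have "(\<integral>\<^sup>+y. f (c + y *\<^sub>R e + h (c + y *\<^sub>R e) *\<^sub>R e) \<partial>lborel) = (\<integral>\<^sup>+y. f (c + y *\<^sub>R e) \<partial>lborel)" for c
    using nn_integral_real_affine[of "\<lambda>y. f (c + y *\<^sub>R e)" 1 "h c"]
    by (simp add: h scaleR_add_left add_ac)
  then show ?thesis
    by (simp add: Fubini)
qed

text \<open>The preimage of a box is the box with permuted sides, which has the same volume, and a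
  measure that agrees with \<open>lborel\<close> on boxes equals it.\<close>

lemma nn_integral_lborel_permute:
  fixes f :: "real^'n \<Rightarrow> ennreal"
  assumes p: "p permutes UNIV" and [measurable]: "f \<in> borel_measurable borel"
  shows "(\<integral>\<^sup>+x. f (\<chi> i. x $ p i) \<partial>lborel) = (\<integral>\<^sup>+x. f x \<partial>lborel)"
proof -
  let ?T = "\<lambda>x::real^'n. \<chi> i. x $ p i"
  have T[measurable]: "?T \<in> borel \<rightarrow>\<^sub>M borel"
    by (intro borel_measurable_continuous_onI continuous_intros)
  have "lborel = distr lborel borel ?T"
  proof (rule lborel_eqI)
    fix l u :: "real^'n" assume le: "\<And>b. b \<in> Basis \<Longrightarrow> l \<bullet> b \<le> u \<bullet> b"
    let ?q = "inv p"
    have pq: "p (?q i) = i" "?q (p i) = i" for i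
      using p by (simp_all add: permutes_inverses)
    have "?T -` box l u = box (\<chi> i. l $ ?q i) (\<chi> i. u $ ?q i)"
      by (auto simp: mem_box_cart pq) (metis pq)+
    moreover have "(\<chi> i. l $ ?q i) \<bullet> b \<le> (\<chi> i. u $ ?q i) \<bullet> b" if "b \<in> Basis" for b
      using that le[of "axis (?q _) 1"] by (auto simp: Basis_vec_def inner_axis axis_eq_axis)
    ultimately have "emeasure (distr lborel borel ?T) (box l u) = ennreal (\<Prod>i\<in>UNIV. (u - l) $ ?q i)"
      by (simp add: emeasure_distr emeasure_lborel_box prod_Basis_cart inner_axis)
    also have "(\<Prod>i\<in>UNIV. (u - l) $ ?q i) = (\<Prod>i\<in>UNIV. (u - l) $ i)"
      using prod.permute[OF permutes_inv[OF p], of "\<lambda>i. (u - l) $ i"] by (simp add: o_def)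
    finally show "emeasure (distr lborel borel ?T) (box l u) = (\<Prod>b\<in>Basis. (u - l) \<bullet> b)"
      by (simp add: prod_Basis_cart inner_axis)
  qed simp
  then show ?thesis
    using nn_integral_distr[of ?T lborel borel f] by simp
qed

text \<open>The library's change of variables requires a well-ordered index type, whereas buses only form a
  finite type; hence this direct induction over elementary matrices.\<close>

lemma nn_integral_lborel_linear:
  fixes A :: "real^'n^'n" and f :: "real^'n \<Rightarrow> ennreal"
  assumes "det A \<noteq> 0" and "f \<in> borel_measurable borel"
  shows "(\<integral>\<^sup>+x. f x \<partial>lborel) = ennreal \<bar>det A\<bar> * (\<integral>\<^sup>+x. f (A *v x) \<partial>lborel)"
proof -
  have meas: "(*v) A \<in> borel \<rightarrow>\<^sub>M borel" for A :: "real^'n^'n"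
    by (intro borel_measurable_continuous_onI linear_continuous_on linear_conv_bounded_linear[THEN iffD1])
       simp
  have "det A \<noteq> 0 \<longrightarrow> (\<forall>f\<in>borel_measurable borel.
      (\<integral>\<^sup>+x. f x \<partial>lborel) = ennreal \<bar>det A\<bar> * (\<integral>\<^sup>+x. f (A *v x) \<partial>lborel))" (is "?P A")
  proof (induction A rule: induct_matrix_elementary_alt)
    case (1 A B)
    show ?case
    proof (intro impI ballI)
      fix f :: "real^'n \<Rightarrow> ennreal" assume nz: "det (A ** B) \<noteq> 0" and f: "f \<in> borel_measurable borel"
      have "(\<lambda>x. f (A *v x)) \<in> borel_measurable borel"
        using measurable_compose[OF meas f] .
      then have "(\<integral>\<^sup>+x. f (A *v x) \<partial>lborel) = ennreal \<bar>det B\<bar> * (\<integral>\<^sup>+x. f (A *v (B *v x)) \<partial>lborel)"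
        using 1(2)[rule_format, of "\<lambda>x. f (A *v x)"] nz by (simp add: det_mul)
      moreover have "(\<integral>\<^sup>+x. f x \<partial>lborel) = ennreal \<bar>det A\<bar> * (\<integral>\<^sup>+x. f (A *v x) \<partial>lborel)"
        using 1(1)[rule_format, of f] nz f by (simp add: det_mul)
      ultimately show "(\<integral>\<^sup>+x. f x \<partial>lborel) = ennreal \<bar>det (A ** B)\<bar> * (\<integral>\<^sup>+x. f (A ** B *v x) \<partial>lborel)"
        by (simp add: det_mul abs_mult ennreal_mult mult.assoc matrix_vector_mul_assoc[symmetric])
    qed
  next
    \<comment> \<open>A zero row makes the determinant vanish, so the implication is
      vacuous.\<close>
    case (2 A i)
    then show ?case by (simp add: det_zero_row)
  next
    \<comment> \<open>A diagonal matrix rescales each axis separately, with factor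
      \<open>c b\<close> on the axis of \<open>b\<close>.\<close>
    case (3 A)
    show ?case
    proof (intro impI ballI)
      fix f :: "real^'n \<Rightarrow> ennreal" assume nz: "det A \<noteq> 0" and f: "f \<in> borel_measurable borel"
      have det: "det A = (\<Prod>i\<in>UNIV. A $ i $ i)"
        by (rule det_diagonal) (use 3 in auto)
      have Ab: "(A *v axis i 1) \<bullet> axis i 1 = A $ i $ i" for i
        by (simp add: inner_axis matrix_vector_mult_basis column_def)
      define c where "c b = (A *v b) \<bullet> b" for b
      have T: "(\<lambda>x. 0 + (\<Sum>b\<in>Basis. (c b * (x \<bullet> b)) *\<^sub>R b)) = (*v) A"
      proof (intro ext euclidean_eqI[where 'a = "real^'n"])
        fix x b :: "real^'n" assume "b \<in> Basis"
        then obtain i where b: "b = axis i 1" by (auto simp: Basis_vec_def)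
        have "(A *v x) $ i = (\<Sum>j\<in>UNIV. A $ i $ j * x $ j)"
          by (simp add: matrix_vector_mult_def)
        also have "\<dots> = A $ i $ i * x $ i"
          using 3 by (subst sum.remove[of _ i]) (auto intro!: sum.neutral)
        finally show "(0 + (\<Sum>b\<in>Basis. (c b * (x \<bullet> b)) *\<^sub>R b)) \<bullet> b = (A *v x) \<bullet> b"
          using \<open>b \<in> Basis\<close> Ab[of i] by (simp add: inner_sum_left_Basis) (simp add: b c_def inner_axis)
      qed
      have "c b \<noteq> 0" if "b \<in> Basis" for b
        using that nz Ab det by (auto simp: Basis_vec_def c_def)
      from lborel_affine_euclidean[of c 0, OF this]
      have "lborel = density (distr lborel borel ((*v) A)) (\<lambda>_. ennreal \<bar>det A\<bar>)"
        unfolding T prod_Basis_cart by (simp add: c_def Ab det abs_prod)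
      then have "(\<integral>\<^sup>+x. f x \<partial>lborel) = (\<integral>\<^sup>+x. f x \<partial>density (distr lborel borel ((*v) A)) (\<lambda>_. ennreal \<bar>det A\<bar>))"
        by simp
      also have "\<dots> = ennreal \<bar>det A\<bar> * (\<integral>\<^sup>+x. f (A *v x) \<partial>lborel)"
        using f meas[of A] by (simp add: nn_integral_density nn_integral_distr nn_integral_cmult measurable_compose)
      finally show "(\<integral>\<^sup>+x. f x \<partial>lborel) = ennreal \<bar>det A\<bar> * (\<integral>\<^sup>+x. f (A *v x) \<partial>lborel)" .
    qed
  next
    case (4 m n)
    let ?p = "Transposition.transpose m n"
    let ?A = "\<chi> i j. mat 1 $ i $ ?p j :: real^'n^'n"
    have p: "?p permutes UNIV" by (simp add: permutes_swap_id)
    have "det ?A = of_int (sign ?p)"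
      using det_permute_columns[OF p, of "mat 1 :: real^'n^'n"] by simp
    then have "\<bar>det ?A\<bar> = 1" by (simp add: sign_def)
    moreover have "?A *v x = (\<chi> i. x $ ?p i)" for x
    proof -
      have "mat 1 $ i $ ?p j = (if j = ?p i then 1 else 0 :: real)" for i j
        by (auto simp: mat_def)
      then show ?thesis
        by (simp add: matrix_vector_mult_def vec_eq_iff if_distrib[of "\<lambda>x. x * _"] cong: if_cong)
    qed
    ultimately show ?case
      using nn_integral_lborel_permute[OF p] by simp
  next
    case (5 m n)
    let ?A = "\<chi> i j. of_bool (i = m \<and> j = n \<or> i = j) :: real^'n^'n"
    \<comment> \<open>Adding row \<open>n\<close> of the identity to row \<open>m\<close> gives
      \<open>?A\<close>; so its determinant is 1, and as a map it is a shear along axis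
      \<open>m\<close> by coordinate \<open>n\<close>.\<close>
    have "?A = (\<chi> k. if k = m then row m (mat 1) + 1 *s row n (mat 1) else row k (mat 1))"
      using 5 by (auto simp: vec_eq_iff row_def mat_def)
    then have "det ?A = 1"
      using det_row_operation[OF 5, of "mat 1 :: real^'n^'n" 1] by simp
    moreover have "?A *v x = x + x $ n *\<^sub>R axis m 1" for x
    proof -
      have "(\<Sum>j\<in>UNIV. of_bool (i = m \<and> j = n \<or> i = j) * x $ j) = x $ i + (if i = m then x $ n else 0)" for i
      proof -
        have "of_bool (i = m \<and> j = n \<or> i = j) * x $ j
            = (if j = i then x $ j else 0) + (if j = n then (if i = m then x $ j else 0) else 0)" for j
          using 5 by auto
        then show ?thesis
          by (simp add: sum.distrib)
      qed
      then show ?thesis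
        by (simp add: vec_eq_iff matrix_vector_mult_def axis_def)
    qed
    moreover have "(\<lambda>x::real^'n. x $ n) \<in> borel_measurable borel"
      by (intro borel_measurable_continuous_onI continuous_intros)
    moreover have "axis m (1::real) \<in> Basis" "\<And>x s. (x + s *\<^sub>R axis m (1::real)) $ n = x $ n"
      using 5 by (auto simp: Basis_vec_def axis_def)
    ultimately show ?case
      using nn_integral_lborel_shear[of "axis m 1 :: real^'n" _ "\<lambda>x. x $ n"] by simp
  qed
  with assms show ?thesis by blast
qed

lemma nn_integral_lborel_translate:
  fixes f :: "'a::euclidean_space \<Rightarrow> ennreal"
  assumes [measurable]: "f \<in> borel_measurable borel"
  shows "(\<integral>\<^sup>+x. f (c + x) \<partial>lborel) = (\<integral>\<^sup>+x. f x \<partial>lborel)"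
  using nn_integral_distr[of "(+) c" lborel borel f] by (simp add: lborel_distr_plus)

section \<open>Gaussian mass of a half-space\<close>

lemma inner_matrix_vector_sym:
  fixes S :: "real^'n^'n"
  assumes "transpose S = S"
  shows "x \<bullet> (S *v y) = (S *v x) \<bullet> y"
  by (metis assms dot_lmul_matrix transpose_matrix_vector)

text \<open>Gram--Schmidt for the inner product \<open>x \<bullet> (S *v y)\<close>, started at \<open>w\<close>.\<close>

lemma exists_conjugate_family:
  fixes S :: "real^'n^'n"
  assumes S: "sym_pos_def S" and w: "w \<bullet> (S *v w) = 1"
  shows "\<exists>v :: 'n \<Rightarrow> real^'n. v k = w \<and> (\<forall>i\<in>insert k J. \<forall>j\<in>insert k J. v i \<bullet> (S *v v j) = (if i = j then 1 else 0))"
proof -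
  have "finite J" by simp
  then show ?thesis
  proof (induction J rule: finite_induct)
    case empty
    show ?case using w by (intro exI[of _ "\<lambda>_. w"]) simp
  next
    case (insert x J)
    then obtain v where vk: "v k = w"
      and v: "\<And>i j. i \<in> insert k J \<Longrightarrow> j \<in> insert k J \<Longrightarrow> v i \<bullet> (S *v v j) = (if i = j then 1 else 0)"
      by blast
    show ?case
    proof (cases "x = k")
      case True
      then show ?thesis using vk v by (intro exI[of _ v]) auto
    next
      case False
      let ?K = "insert k J"
      have "x \<notin> ?K" using False insert by simp
      then have "?K \<subset> UNIV" by blast
      \<comment> \<open>Dimension count: fewer than \<open>CARD('n)\<close> vectors
        \<open>S *v v i\<close> cannot span the space. A nonzero \<open>y\<close> orthogonal to all
        of them is conjugate to every \<open>v i\<close> and only needs rescaling.\<close>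
      then have "card ?K < CARD('n)" by (intro psubset_card_mono) auto
      moreover have "dim ((\<lambda>i. S *v v i) ` ?K) \<le> card ((\<lambda>i. S *v v i) ` ?K)"
        by (intro dim_le_card') simp
      moreover have "card ((\<lambda>i. S *v v i) ` ?K) \<le> card ?K"
        by (intro card_image_le) simp
      ultimately have "dim ((\<lambda>i. S *v v i) ` ?K) < DIM(real^'n)"
        by simp
      then obtain y where y: "y \<noteq> 0" "\<And>z. z \<in> span ((\<lambda>i. S *v v i) ` ?K) \<Longrightarrow> orthogonal y z"
        by (rule orthogonal_to_subspace_exists) blast
      have y1: "y \<bullet> (S *v v i) = 0" if "i \<in> ?K" for i
        using y(2)[of "S *v v i"] that by (auto simp: orthogonal_def intro: span_base)
      have y2: "v i \<bullet> (S *v y) = 0" if "i \<in> ?K" for i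
      proof -
        have "transpose S = S" using S by (simp add: sym_pos_def_def)
        then have "v i \<bullet> (S *v y) = (S *v v i) \<bullet> y" by (rule inner_matrix_vector_sym)
        then show ?thesis using y1[OF that] by (simp only: inner_commute)
      qed
      have pos: "0 < y \<bullet> (S *v y)" using S y(1) by (simp add: sym_pos_def_def)
      define c where "c = 1 / sqrt (y \<bullet> (S *v y))"
      have c: "c * (c * (y \<bullet> (S *v y))) = 1"
        using pos by (simp add: c_def field_simps)
      have "(v(x := c *\<^sub>R y)) i \<bullet> (S *v (v(x := c *\<^sub>R y)) j) = (if i = j then 1 else 0)"
        if "i \<in> insert k (insert x J)" "j \<in> insert k (insert x J)" for i j
      proof (cases "i = x"; cases "j = x")
        assume "i = x" "j = x"
        then show ?thesis using c by (simp add: matrix_vector_mult_scaleR)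
      next
        assume "i = x" "j \<noteq> x"
        then show ?thesis using that y1[of j] by simp
      next
        assume "i \<noteq> x" "j = x"
        then show ?thesis using that y2[of i] by (simp add: matrix_vector_mult_scaleR)
      next
        assume "i \<noteq> x" "j \<noteq> x"
        then show ?thesis using that v[of i j] by simp
      qed
      moreover have "(v(x := c *\<^sub>R y)) k = w" using False vk by simp
      ultimately show ?thesis by blast
    qed
  qed
qed

text \<open>The conjugate family over all indices forms the columns of \<open>V\<close>. The vector
  \<open>a\<close> is rescaled to unit length in the inner product given by \<open>S\<close> and
  becomes column \<open>k\<close>.\<close>

lemma exists_conjugate_basis:
  fixes S :: "real^'n^'n"
  assumes S: "sym_pos_def S" and a: "a \<noteq> 0"
  obtains V :: "real^'n^'n" where "transpose V ** S ** V = mat 1"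
    and "column k V = (1 / sqrt (a \<bullet> (S *v a))) *\<^sub>R a"
proof -
  define w where "w = (1 / sqrt (a \<bullet> (S *v a))) *\<^sub>R a"
  have "0 < a \<bullet> (S *v a)" using S a by (simp add: sym_pos_def_def)
  then have "1 / sqrt (a \<bullet> (S *v a)) * (1 / sqrt (a \<bullet> (S *v a)) * (a \<bullet> (S *v a))) = 1"
    by (simp add: field_simps)
  then have "w \<bullet> (S *v w) = 1"
    by (simp only: w_def matrix_vector_mult_scaleR inner_scaleR_left inner_scaleR_right)
  from exists_conjugate_family[OF S this, of k UNIV]
  obtain v where vk: "v k = w" and v: "v i \<bullet> (S *v v j) = (if i = j then 1 else 0)" for i j
    by (metis UNIV_I insertI2)
  define V where "V = (\<chi> i j. v j $ i)"
  have col: "column j V = v j" for j by (simp add: V_def column_def vec_eq_iff)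
  have "(transpose V ** S ** V) $ i $ j = mat 1 $ i $ j" for i j
  proof -
    have "(transpose V ** S ** V) $ i $ j = axis i 1 \<bullet> ((transpose V ** S ** V) *v axis j 1)"
      by (simp only: inner_axis' matrix_vector_mult_basis column_def vec_lambda_beta inner_real_def mult_1)
    also have "\<dots> = (axis i 1 v* transpose V) \<bullet> (S *v (V *v axis j 1))"
      by (simp only: dot_lmul_matrix matrix_vector_mul_assoc[symmetric])
    also have "axis i 1 v* transpose V = V *v axis i 1"
      using transpose_matrix_vector[of "transpose V" "axis i 1"] by (simp only: transpose_transpose)
    finally have "(transpose V ** S ** V) $ i $ j = v i \<bullet> (S *v v j)"
      by (simp only: matrix_vector_mult_basis col)
    then show ?thesis by (simp only: v mat_def vec_lambda_beta)
  qed
  then have "transpose V ** S ** V = mat 1" by (simp add: vec_eq_iff)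
  moreover have "column k V = (1 / sqrt (a \<bullet> (S *v a))) *\<^sub>R a"
    using vk col[of k] by (simp only: w_def)
  ultimately show thesis by (rule that)
qed

lemma sym_pos_def_det_pos:
  fixes S :: "real^'n^'n"
  assumes "sym_pos_def S"
  shows "0 < det S"
proof -
  \<comment> \<open>Any nonzero vector can start the basis; the all-ones vector serves here.\<close>
  obtain V :: "real^'n^'n" where V: "transpose V ** S ** V = mat 1"
    using exists_conjugate_basis[OF assms one_neq_zero] by metis
  from arg_cong[OF V, of det] have "(det V)\<^sup>2 * det S = 1"
    by (simp add: det_mul power2_eq_square mult_ac)
  then have "\<not> det S \<le> 0"
    using mult_nonneg_nonpos[of "(det V)\<^sup>2" "det S"] by auto
  then show ?thesis by simp
qed

lemma Phi_emeasure: "emeasure std_normal_distribution {..c} = ennreal (Phi c)"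
proof -
  interpret real_distribution std_normal_distribution by (rule real_dist_normal_dist)
  show ?thesis by (simp add: Phi_def cdf_def emeasure_eq_measure)
qed

lemma mvn_density_borel_measurable [measurable]: "mvn_density nu S \<in> borel_measurable borel"
proof -
  have "continuous_on UNIV (\<lambda>x. (x - nu) \<bullet> (matrix_inv S *v (x - nu)))"
    by (intro continuous_intros linear_continuous_on_compose[where g = "(*v) (matrix_inv S)"]) simp_all
  then have [measurable]: "(\<lambda>x. (x - nu) \<bullet> (matrix_inv S *v (x - nu))) \<in> borel_measurable borel"
    by (rule borel_measurable_continuous_onI)
  show ?thesis unfolding mvn_density_def by measurable
qed

text \<open>The integrand is a product of functions of one coordinate each. The half-space restricts
  only coordinate \<open>k\<close>, whose factor integrates to \<open>Phi c\<close>; every other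
  factor integrates to 1.\<close>

lemma nn_integral_std_normal_halfspace:
  "(\<integral>\<^sup>+z. ennreal (exp (- (z \<bullet> z) / 2) / sqrt ((2 * pi) ^ CARD('n))) * indicator {z. z $ k \<le> c} z
      \<partial>(lborel :: (real^'n) measure)) = ennreal (Phi c)"
proof -
  define g where "g b t = ennreal (std_normal_density t) * (if b = axis k 1 then indicator {..c} t else 1)"
    for b :: "real^'n" and t
  have meas: "g b \<in> borel_measurable borel" for b
    unfolding g_def by simp
  have split: "ennreal (exp (- (z \<bullet> z) / 2) / sqrt ((2 * pi) ^ CARD('n))) * indicator {z. z $ k \<le> c} z
      = (\<Prod>b\<in>Basis. g b (z \<bullet> b))" for z :: "real^'n"
  proof -
    have "(\<Prod>i\<in>UNIV. std_normal_density (z $ i)) = exp (- (z \<bullet> z) / 2) / sqrt ((2 * pi) ^ CARD('n))"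
      by (simp add: std_normal_density_def prod.distrib prod_dividef exp_sum[symmetric] sum_negf
          sum_divide_distrib[symmetric] inner_vec_def power2_eq_square
          real_sqrt_power real_sqrt_mult power_mult_distrib)
    then have "ennreal (exp (- (z \<bullet> z) / 2) / sqrt ((2 * pi) ^ CARD('n)))
        = (\<Prod>i\<in>UNIV. ennreal (std_normal_density (z $ i)))"
      by (simp add: prod_ennreal)
    then show ?thesis
      by (simp add: prod_Basis_cart g_def inner_axis prod.distrib axis_eq_axis indicator_def prod.delta)
  qed
  have "(\<integral>\<^sup>+t. g b t \<partial>lborel) = (if b = axis k 1 then ennreal (Phi c) else 1)" for b
  proof -
    have "(\<integral>\<^sup>+t. ennreal (std_normal_density t) \<partial>lborel) = 1"
      using prob_space.emeasure_space_1[OF prob_space_normal_density[of 1 0]]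
      by (simp add: emeasure_density)
    then show ?thesis
      using Phi_emeasure[of c] by (simp add: g_def emeasure_density)
  qed
  then have "(\<Prod>b\<in>Basis. (\<integral>\<^sup>+t. g b t \<partial>lborel)) = ennreal (Phi c)"
    by (simp add: prod_Basis_cart axis_eq_axis)
  then show ?thesis
    unfolding split by (subst nn_integral_lborel_prod) (simp_all add: meas)
qed

text \<open>The substitution \<open>x = nu + L *v z\<close> turns the density into the standard one
  and the half-space into a bound on the single coordinate \<open>z $ k\<close>.\<close>

lemma nn_integral_mvn_density_halfspace:
  fixes S :: "real^'n^'n"
  assumes S: "sym_pos_def S" and a: "a \<noteq> 0"
  shows "(\<integral>\<^sup>+x. ennreal (mvn_density nu S x) * indicator {x. a \<bullet> x \<le> b} x \<partial>lborel)
    = ennreal (Phi ((b - nu \<bullet> a) / sqrt (a \<bullet> (S *v a))))"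
proof -
  define \<sigma> where "\<sigma> = sqrt (a \<bullet> (S *v a))"
  have \<sigma>: "0 < \<sigma>" "\<sigma> * \<sigma> = a \<bullet> (S *v a)"
    using S a by (simp_all add: \<sigma>_def sym_pos_def_def less_imp_le)
  have sym: "transpose S = S" using S by (simp add: sym_pos_def_def)
  obtain V and k :: 'n where V: "transpose V ** S ** V = mat 1" and col: "column k V = (1 / \<sigma>) *\<^sub>R a"
    unfolding \<sigma>_def by (rule exists_conjugate_basis[OF S a])
  have "det V * det S * det V = 1"
    using arg_cong[OF V, of det] by (simp add: det_mul)
  then have det: "(det V)\<^sup>2 * det S = 1" by (simp add: power2_eq_square mult.commute mult.left_commute)
  have "0 < det S" by (rule sym_pos_def_det_pos[OF S])
  \<comment> \<open>With this choice \<open>matrix_inv S\<close> takes \<open>L *v z\<close> to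
    \<open>V *v z\<close>, so conjugacy turns the quadratic form in the exponent into
    \<open>z \<bullet> z\<close>. Since column \<open>k\<close> of \<open>V\<close> is
    \<open>a\<close> divided by \<open>\<sigma>\<close>, it also gives
    \<open>a \<bullet> (L *v z) = \<sigma> * z $ k\<close>.\<close>
  define L where "L = S ** V"
  \<comment> \<open>This Jacobian cancels the factor \<open>sqrt (det S)\<close> in the
    normalisation of the density.\<close>
  have detL: "\<bar>det L\<bar> = sqrt (det S)"
  proof -
    have "(det L)\<^sup>2 = det S * ((det V)\<^sup>2 * det S)"
      by (simp add: L_def det_mul power2_eq_square)
    then show ?thesis using det by (metis mult.right_neutral real_sqrt_abs)
  qed
  have "invertible S" using \<open>0 < det S\<close> by (simp add: invertible_det_nz)
  then have "S ** matrix_inv S = mat 1 \<and> matrix_inv S ** S = mat 1"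
    unfolding invertible_def matrix_inv_def by (rule someI_ex)
  then have inv: "matrix_inv S *v (L *v z) = V *v z" for z
    by (simp add: L_def matrix_vector_mul_assoc matrix_mul_assoc)
  have conj: "(V *v y) \<bullet> (L *v z) = y \<bullet> z" for y z
  proof -
    have "(V *v y) \<bullet> (L *v z) = (y v* transpose V) \<bullet> (S *v (V *v z))"
      by (simp add: L_def matrix_vector_mul_assoc)
    also have "\<dots> = y \<bullet> ((transpose V ** S ** V) *v z)"
      by (simp only: dot_lmul_matrix matrix_vector_mul_assoc[symmetric])
    finally show ?thesis by (simp add: V)
  qed
  have proj: "a \<bullet> (L *v z) = \<sigma> * z $ k" for z
  proof -
    have "a = \<sigma> *\<^sub>R (V *v axis k 1)" using col \<sigma> by (simp add: matrix_vector_mult_basis)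
    then have "a \<bullet> (L *v z) = \<sigma> * ((V *v axis k 1) \<bullet> (L *v z))"
      by (metis inner_scaleR_left)
    then show ?thesis by (simp add: conj inner_axis')
  qed
  let ?c = "(b - nu \<bullet> a) / \<sigma>"
  define f where "f x = ennreal (mvn_density nu S x) * indicator {x. a \<bullet> x \<le> b} x" for x
  have f[measurable]: "f \<in> borel_measurable borel"
    unfolding f_def by measurable
  have pull: "ennreal \<bar>det L\<bar> * f (nu + L *v z)
      = ennreal (exp (- (z \<bullet> z) / 2) / sqrt ((2 * pi) ^ CARD('n))) * indicator {z. z $ k \<le> ?c} z" for z
  proof -
    have "(L *v z) \<bullet> (V *v z) = z \<bullet> z" by (metis conj inner_commute)
    then have "\<bar>det L\<bar> * mvn_density nu S (nu + L *v z) = exp (- (z \<bullet> z) / 2) / sqrt ((2 * pi) ^ CARD('n))"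
      using \<open>0 < det S\<close> by (simp add: mvn_density_def inv detL real_sqrt_mult)
    moreover have "a \<bullet> (nu + L *v z) \<le> b \<longleftrightarrow> z $ k \<le> ?c"
      using \<sigma>(1) by (simp add: inner_add_right proj pos_le_divide_eq inner_commute mult.commute) argo
    ultimately show ?thesis
      by (simp add: f_def ennreal_mult'[symmetric] mult.assoc[symmetric] indicator_def)
  qed
  have "(\<integral>\<^sup>+x. f x \<partial>lborel) = (\<integral>\<^sup>+x. f (nu + x) \<partial>lborel)"
    by (simp add: nn_integral_lborel_translate)
  also have "\<dots> = ennreal \<bar>det L\<bar> * (\<integral>\<^sup>+z. f (nu + L *v z) \<partial>lborel)"
    using detL \<open>0 < det S\<close> by (intro nn_integral_lborel_linear[where f = "\<lambda>x. f (nu + x)"]) auto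
  also have "\<dots> = (\<integral>\<^sup>+z. ennreal \<bar>det L\<bar> * f (nu + L *v z) \<partial>lborel)"
  proof (rule nn_integral_cmult[symmetric])
    have "(\<lambda>z. nu + L *v z) \<in> borel \<rightarrow>\<^sub>M borel"
      by (intro borel_measurable_continuous_onI continuous_intros linear_continuous_on
            linear_conv_bounded_linear[THEN iffD1]) simp
    then show "(\<lambda>z. f (nu + L *v z)) \<in> borel_measurable lborel" by simp
  qed
  also have "\<dots> = ennreal (Phi ?c)"
    unfolding pull by (rule nn_integral_std_normal_halfspace)
  finally show ?thesis by (simp add: f_def \<sigma>_def)
qed

lemma mvn_density_nonneg:
  assumes "sym_pos_def S"
  shows "0 \<le> mvn_density nu S x"
  using sym_pos_def_det_pos[OF assms] by (simp add: mvn_density_def)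

text \<open>Integrating the density over the half-space and exchanging the integral with the finite
  sum leaves one Gaussian half-space mass per component.\<close>

lemma mixture_halfspace_prob:
  assumes "prob_space M" and mix: "valid_mixture mix"
    and \<omega>: "distributed M lborel \<omega> (\<lambda>w. ennreal (mixture_density mix w))" and a: "a \<noteq> 0"
  shows "\<P>(\<xi> in M. a \<bullet> \<omega> \<xi> \<le> b)
    = (\<Sum>j\<in>comps mix. weight mix j * Phi ((b - cmean mix j \<bullet> a) / sqrt (a \<bullet> (ccov mix j *v a))))"
proof -
  interpret prob_space M by fact
  let ?H = "{x. a \<bullet> x \<le> b}"
  let ?P = "\<lambda>j. Phi ((b - cmean mix j \<bullet> a) / sqrt (a \<bullet> (ccov mix j *v a)))"
  let ?f = "\<lambda>j. mvn_density (cmean mix j) (ccov mix j)"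
  have Phi0: "0 \<le> Phi c" for c by (simp add: Phi_def cdf_def)
  have w: "0 \<le> weight mix j" "sym_pos_def (ccov mix j)" if "j \<in> comps mix" for j
    using mix that by (auto simp: valid_mixture_def)
  have f0: "0 \<le> ?f j x" if "j \<in> comps mix" for j x
    using w(2)[OF that] by (rule mvn_density_nonneg)
  have "{\<xi> \<in> space M. a \<bullet> \<omega> \<xi> \<le> b} = \<omega> -` ?H \<inter> space M" by auto
  then have "ennreal (\<P>(\<xi> in M. a \<bullet> \<omega> \<xi> \<le> b)) = (\<integral>\<^sup>+x. ennreal (mixture_density mix x) * indicator ?H x \<partial>lborel)"
    using distributed_emeasure[OF \<omega>, of ?H] by (simp add: emeasure_eq_measure)
  also have "\<dots> = (\<integral>\<^sup>+x. (\<Sum>j\<in>comps mix. ennreal (weight mix j) * (ennreal (?f j x) * indicator ?H x)) \<partial>lborel)"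
  proof (intro nn_integral_cong)
    fix x
    have "ennreal (mixture_density mix x) = (\<Sum>j\<in>comps mix. ennreal (weight mix j) * ennreal (?f j x))"
      unfolding mixture_density_def using w f0
      by (subst sum_ennreal[symmetric]) (auto intro!: sum.cong simp: ennreal_mult)
    then show "ennreal (mixture_density mix x) * indicator ?H x
        = (\<Sum>j\<in>comps mix. ennreal (weight mix j) * (ennreal (?f j x) * indicator ?H x))"
      by (simp add: sum_distrib_right mult.assoc)
  qed
  also have "\<dots> = (\<Sum>j\<in>comps mix. ennreal (weight mix j) * (\<integral>\<^sup>+x. ennreal (?f j x) * indicator ?H x \<partial>lborel))"
    by (simp add: nn_integral_sum nn_integral_cmult)
  also have "\<dots> = (\<Sum>j\<in>comps mix. ennreal (weight mix j * ?P j))"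
    using w Phi0 a by (intro sum.cong) (auto simp: nn_integral_mvn_density_halfspace ennreal_mult)
  also have "\<dots> = ennreal (\<Sum>j\<in>comps mix. weight mix j * ?P j)"
    using w Phi0 by (intro sum_ennreal) auto
  finally show ?thesis
    using w Phi0 by (subst (asm) ennreal_inj) (auto intro!: sum_nonneg)
qed

section \<open>The piecewise linear and binary approximation\<close>

lemma Phi_mono: "x \<le> y \<Longrightarrow> Phi x \<le> Phi y"
proof -
  interpret real_distribution std_normal_distribution by (rule real_dist_normal_dist)
  show "x \<le> y \<Longrightarrow> Phi x \<le> Phi y" by (simp add: Phi_def cdf_nondecreasing)
qed

text \<open>The increment is the integral of the density over \<open>{x<..y}\<close>. The density
  decreases on the nonnegative reals, so its values at the two endpoints give lower and upper
  rectangles.\<close>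

lemma Phi_increment_bounds:
  assumes "0 \<le> x" "x < y"
  shows "(y - x) * std_normal_density y \<le> Phi y - Phi x"
    and "Phi y - Phi x \<le> (y - x) * std_normal_density x"
proof -
  interpret real_distribution std_normal_distribution by (rule real_dist_normal_dist)
  have diff: "ennreal (Phi y - Phi x) = (\<integral>\<^sup>+t. ennreal (std_normal_density t) * indicator {x<..y} t \<partial>lborel)"
    using cdf_diff_eq[OF assms(2)]
    by (simp add: Phi_def emeasure_eq_measure[symmetric] emeasure_density)
  have le: "std_normal_density t \<le> std_normal_density s" if "0 \<le> s" "s \<le> t" for s t
    using that by (auto simp: std_normal_density_def divide_right_mono power_mono)
  have const: "(\<integral>\<^sup>+t. ennreal c * indicator {x<..y} t \<partial>lborel) = ennreal ((y - x) * c)" if "0 \<le> c" for c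
    using assms that by (simp add: nn_integral_cmult_indicator ennreal_mult mult.commute)
  have "ennreal ((y - x) * std_normal_density y) \<le> ennreal (Phi y - Phi x)"
    unfolding diff const[OF normal_density_nonneg, symmetric]
    using assms by (intro nn_integral_mono) (auto simp: indicator_def intro!: ennreal_leI le)
  then show "(y - x) * std_normal_density y \<le> Phi y - Phi x"
    using Phi_mono[of x y] assms by (simp add: ennreal_le_iff)
  have "ennreal (Phi y - Phi x) \<le> ennreal ((y - x) * std_normal_density x)"
    unfolding diff const[OF normal_density_nonneg, symmetric]
    using assms by (intro nn_integral_mono) (auto simp: indicator_def intro!: ennreal_leI le)
  then show "Phi y - Phi x \<le> (y - x) * std_normal_density x"
    using assms by (simp add: ennreal_le_iff)
qed

text \<open>\<open>Phi\<close> is concave on the nonnegative reals because its density decreases there.\<close>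

lemma chord_le_Phi:
  assumes "0 \<le> x" "x < y" "x \<le> s" "s \<le> y"
    and "k * x + c = Phi x" and "k * y + c = Phi y"
  shows "k * s + c \<le> Phi s"
proof (cases "s = x \<or> s = y")
  case True
  then show ?thesis using assms by auto
next
  case False
  then have s: "x < s" "s < y" using assms by auto
  \<comment> \<open>The density at \<open>s\<close> separates the two secant slopes: it bounds the
    one over the interval from \<open>x\<close> to \<open>s\<close> from below and the one from
    \<open>s\<close> to \<open>y\<close> from above.\<close>
  have "(s - x) * std_normal_density s \<le> Phi s - Phi x"
    using Phi_increment_bounds(1)[of x s] assms s by simp
  then have "(y - s) * ((s - x) * std_normal_density s) \<le> (y - s) * (Phi s - Phi x)"
    using s by (intro mult_left_mono) auto
  moreover have "Phi y - Phi s \<le> (y - s) * std_normal_density s"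
    using Phi_increment_bounds(2)[of s y] assms s by simp
  then have "(s - x) * (Phi y - Phi s) \<le> (s - x) * ((y - s) * std_normal_density s)"
    using s by (intro mult_left_mono) auto
  ultimately have "0 \<le> (y - s) * (Phi s - Phi x) - (s - x) * (Phi y - Phi s)"
    by (simp add: mult.left_commute)
  \<comment> \<open>As the affine function interpolates at \<open>x\<close> and \<open>y\<close>,
    the cross-multiplied slope difference is a positive multiple of the gap at
    \<open>s\<close>.\<close>
  also have "\<dots> = (y - x) * (Phi s - (k * s + c))"
    unfolding assms(5,6)[symmetric] by (simp add: algebra_simps)
  finally show ?thesis
    using assms(2) by (simp add: zero_le_mult_iff)
qed

text \<open>The minimum is at most the affine function of the piece containing \<open>s\<close>, and
  on that piece this function is a chord of \<open>Phi\<close>.\<close>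

lemma piecewise_linear_le_Phi:
  assumes D: "valid_approx D" and s: "smin D \<le> s" "s \<le> smax D"
  shows "Min ((\<lambda>n. slope D n * s + intercept D n) ` {1..npieces D}) \<le> Phi s"
proof -
  let ?x = "breakpoint D" and ?N = "npieces D"
  have x0: "?x 0 = smin D" and xN: "?x ?N = smax D" and "0 \<le> smin D" "smin D < smax D"
    and piece: "\<And>n. n \<in> {1..?N} \<Longrightarrow> ?x (n - 1) < ?x n \<and>
        slope D n * ?x (n - 1) + intercept D n = Phi (?x (n - 1)) \<and>
        slope D n * ?x n + intercept D n = Phi (?x n)"
    using D unfolding valid_approx_def by auto
  have nonneg: "0 \<le> ?x n" if "n \<le> ?N" for n
    using that
  proof (induction n)
    case (Suc n)
    then show ?case using piece[of "Suc n"] by fastforce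
  qed (simp add: x0 \<open>0 \<le> smin D\<close>)
  have "0 < ?N" using x0 xN \<open>smin D < smax D\<close> by (metis bot_nat_0.not_eq_extremum order_less_irrefl)
  \<comment> \<open>The first breakpoint at or beyond \<open>s\<close> is the right end of the piece
    containing \<open>s\<close>. Index 0 is excluded, so for \<open>n = 1\<close> the left bound
    comes from \<open>smin D \<le> s\<close> instead of minimality.\<close>
  define n where "n = (LEAST n. 0 < n \<and> s \<le> ?x n)"
  have "0 < ?N \<and> s \<le> ?x ?N" using s xN \<open>0 < ?N\<close> by simp
  then have n: "0 < n" "s \<le> ?x n" "n \<le> ?N"
    unfolding n_def by (metis (mono_tags, lifting) LeastI, metis (mono_tags, lifting) LeastI, metis (mono_tags, lifting) Least_le)
  have "?x (n - 1) \<le> s"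
  proof (cases "n = 1")
    case False
    then have "\<not> (0 < n - 1 \<and> s \<le> ?x (n - 1))"
      unfolding n_def using n(1) by (intro not_less_Least) (simp add: n_def)
    then show ?thesis using False n(1) by auto
  qed (use s x0 in simp)
  then have "slope D n * s + intercept D n \<le> Phi s"
    using n piece[of n] nonneg[of "n - 1"] by (intro chord_le_Phi[of "?x (n - 1)" "?x n"]) auto
  moreover have "Min ((\<lambda>n. slope D n * s + intercept D n) ` {1..?N}) \<le> slope D n * s + intercept D n"
    using n by (intro Min_le) auto
  ultimately show ?thesis by linarith
qed

text \<open>Every finite partial sum is dominated by a finite geometric sum, which stays below 1.
  Bounding partial sums covers finite and infinite sets of levels alike.\<close>

lemma binary_fraction_le_1:
  fixes z :: "int \<Rightarrow> real"
  assumes "((\<lambda>l. 2 powi l * z l) has_sum v) L" and "L \<subseteq> {..-1}" and "\<And>l. l \<in> L \<Longrightarrow> z l \<le> 1"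
  shows "v \<le> 1"
proof (rule has_sum_le_finite_sums[OF assms(1)])
  fix F assume F: "finite F" "F \<subseteq> L"
  have geo: "(\<Sum>k\<in>{1..n}. 2 powi (- int k)) \<le> (1::real) - 2 powi (- int n)" for n
  proof (induction n)
    case (Suc n)
    have "2 powi (- int n) = 2 * (2::real) powi (- int (Suc n))"
      by (simp add: power_int_minus field_simps del: of_nat_Suc)
    with Suc show ?case by simp
  qed simp
  \<comment> \<open>Negating the levels turns \<open>F\<close> into a set of positive exponents,
    contained in \<open>{1..n}\<close> for some \<open>n\<close>.\<close>
  let ?g = "\<lambda>l. nat (- l)"
  obtain n where n: "?g ` F \<subseteq> {..n}"
    using F(1) by (metis finite_imageI finite_nat_iff_bounded_le)
  have neg: "l \<le> -1" if "l \<in> F" for l using that F assms(2) by auto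
  have "(\<Sum>l\<in>F. 2 powi l * z l) \<le> (\<Sum>l\<in>F. 2 powi l)"
    using F assms(3) by (intro sum_mono) (auto simp: mult_le_cancel_left1 not_less)
  also have "\<dots> = (\<Sum>k\<in>?g ` F. 2 powi (- int k))"
    using neg by (subst sum.reindex) (force simp: inj_on_def intro!: sum.cong)+
  also have "\<dots> \<le> (\<Sum>k\<in>{1..n}. 2 powi (- int k))"
    using n neg by (intro sum_mono2) force+
  also have "\<dots> \<le> 1" using geo[of n] by (smt (verit) zero_less_power_int)
  finally show "(\<Sum>l\<in>F. 2 powi l * z l) \<le> 1" .
qed

text \<open>The binary fraction \<open>vv u j\<close> lies between 0 and 1, which places
  \<open>sv u j\<close> in the range where the chords bound \<open>Phi\<close> from below. The
  linearised product restores \<open>sv u j * tv u j\<close> in the last constraint.\<close>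

lemma approx_chance_component:
  assumes D: "valid_approx D" and u: "approx_chance D mix eps a b u" and j: "j \<in> comps mix"
  shows "yv u j \<le> Phi (sv u j)" and "0 \<le> sv u j" and "sv u j * tv u j + cmean mix j \<bullet> a \<le> b"
    and "sqrt (a \<bullet> (ccov mix j *v a)) \<le> tv u j"
proof -
  have sm: "0 \<le> smin D" "smin D < smax D" and levels: "levels D \<subseteq> {..-1}"
    using D by (auto simp: valid_approx_def)
  have y: "yv u j \<le> Min ((\<lambda>n. slope D n * sv u j + intercept D n) ` {1..npieces D})"
    and s: "sv u j = (smax D - smin D) * vv u j + smin D"
    and v: "((\<lambda>l. 2 powi l * zv u j l) has_sum vv u j) (levels D)"
    and BL: "((\<lambda>l. 2 powi l * blv u j l) has_sum BLv u j) (levels D)"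
    and bits: "\<And>l. l \<in> levels D \<Longrightarrow> zv u j l \<in> {0, 1} \<and>
           tmin D * zv u j l \<le> blv u j l \<and> blv u j l \<le> tmax D * zv u j l \<and>
           - tmax D * (1 - zv u j l) \<le> blv u j l - tv u j \<and>
           blv u j l - tv u j \<le> tmax D * (1 - zv u j l)"
    and b: "(smax D - smin D) * BLv u j + smin D * tv u j + cmean mix j \<bullet> a \<le> b"
    and t: "sqrt (a \<bullet> (ccov mix j *v a)) \<le> tv u j"
    using u j unfolding approx_chance_def by auto
  \<comment> \<open>The big-M constraints linearise the product of the bit with \<open>tv u j\<close>.\<close>
  have bl: "blv u j l = tv u j * zv u j l" if "l \<in> levels D" for l
    using bits[OF that] by auto
  have "((\<lambda>l. tv u j * (2 powi l * zv u j l)) has_sum BLv u j) (levels D)"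
    using BL by (rule has_sum_cong[THEN iffD1, rotated]) (simp add: bl)
  \<comment> \<open>Both values are sums of the same family, and the value of a sum is
    unique.\<close>
  then have BLv: "BLv u j = tv u j * vv u j"
    using has_sum_cmult_right[OF v, of "tv u j"] by (rule has_sum_unique)
  have "0 \<le> vv u j"
    using has_sum_nonneg[OF v] bits by fastforce
  moreover have "vv u j \<le> 1"
    using binary_fraction_le_1[OF v levels] bits by fastforce
  ultimately have "0 \<le> (smax D - smin D) * vv u j" "(smax D - smin D) * vv u j \<le> smax D - smin D"
    using sm by (auto intro: mult_left_le)
  then have "smin D \<le> sv u j" "sv u j \<le> smax D"
    unfolding s by linarith+
  then show "yv u j \<le> Phi (sv u j)" "0 \<le> sv u j"
    using y piecewise_linear_le_Phi[OF D] sm(1) by (force intro: order_trans)+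
  show "sv u j * tv u j + cmean mix j \<bullet> a \<le> b"
    using b by (simp add: BLv s algebra_simps)
  show "sqrt (a \<bullet> (ccov mix j *v a)) \<le> tv u j" by (rule t)
qed

lemma approx_chance_safe:
  assumes "prob_space M" and mix: "valid_mixture mix"
    and \<omega>: "distributed M lborel \<omega> (\<lambda>w. ennreal (mixture_density mix w))"
    and D: "valid_approx D" and "0 \<le> eps" and u: "approx_chance D mix eps a b u"
  shows "1 - eps \<le> \<P>(\<xi> in M. a \<bullet> \<omega> \<xi> \<le> b)"
proof -
  interpret prob_space M by fact
  note comp = approx_chance_component[OF D u]
  show ?thesis
  proof (cases "a = 0")
    \<comment> \<open>With \<open>a = 0\<close> there is no half-space to measure: the event is just
      \<open>0 \<le> b\<close>. Any component gives this, since \<open>sv u j\<close> and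
      \<open>tv u j\<close> are nonnegative; one exists because the weights sum to 1.\<close>
    case True
    have "comps mix \<noteq> {}" using mix by (auto simp: valid_mixture_def)
    then obtain j where "j \<in> comps mix" by blast
    then have "0 \<le> sv u j * tv u j" "sv u j * tv u j \<le> b"
      using comp[of j] True by auto
    then show ?thesis using True \<open>0 \<le> eps\<close> by (simp add: prob_space)
  next
    case False
    have "yv u j \<le> Phi ((b - cmean mix j \<bullet> a) / sqrt (a \<bullet> (ccov mix j *v a)))" if j: "j \<in> comps mix" for j
    proof -
      have pos: "0 < sqrt (a \<bullet> (ccov mix j *v a))"
        using mix j False by (auto simp: valid_mixture_def sym_pos_def_def)
      have "sv u j * sqrt (a \<bullet> (ccov mix j *v a)) \<le> sv u j * tv u j"
        using comp[OF j] by (intro mult_left_mono) auto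
      \<comment> \<open>Replacing \<open>tv u j\<close> by the smaller standard deviation is safe
        because \<open>sv u j\<close> is nonnegative.\<close>
      then have "sv u j \<le> (b - cmean mix j \<bullet> a) / sqrt (a \<bullet> (ccov mix j *v a))"
        using comp(3)[OF j] pos by (simp add: pos_le_divide_eq)
      then show ?thesis using comp(1)[OF j] Phi_mono order_trans by blast
    qed
    then have "(\<Sum>j\<in>comps mix. weight mix j * yv u j) \<le> \<P>(\<xi> in M. a \<bullet> \<omega> \<xi> \<le> b)"
      unfolding mixture_halfspace_prob[OF \<open>prob_space M\<close> mix \<omega> False]
      using mix by (intro sum_mono mult_left_mono) (auto simp: valid_mixture_def)
    then show ?thesis using u by (auto simp: approx_chance_def)
  qed
qed

section \<open>The network constraints\<close>

text \<open>The diagonal entry is the sum of the susceptances at bus \<open>j\<close>, and the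
  off-diagonal entries of its column are their negatives. Irreflexivity ensures that the diagonal
  sum has no self-loop term.\<close>

lemma laplacian_column_sum:
  assumes "valid_network net"
  shows "(\<Sum>i\<in>UNIV. laplacian net $ i $ j) = 0"
proof -
  have jj: "(j, j) \<notin> branches net" using assms by (auto simp: valid_network_def irrefl_def)
  have "(\<Sum>i\<in>UNIV - {j}. laplacian net $ i $ j) = (\<Sum>i\<in>UNIV - {j}. if (i, j) \<in> branches net then - susc net i j else 0)"
    by (intro sum.cong) (auto simp: laplacian_def)
  also have "\<dots> = - (\<Sum>i | (i, j) \<in> branches net. susc net i j)"
    using jj by (subst sum.inter_filter[symmetric]) (auto simp: sum_negf intro!: sum.cong)
  finally show ?thesis
    by (subst sum.remove[of _ j]) (simp_all add: laplacian_def)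
qed

text \<open>Summing the flow equations over all buses annihilates the Laplacian side.\<close>

lemma dc_flow_imp_power_balance:
  assumes "valid_network net" and "dc_flow net x"
  shows "power_balance net x"
proof -
  obtain p \<theta> \<alpha> where x: "x = (p, \<theta>, \<alpha>)" by (cases x)
  have "(\<Sum>i\<in>UNIV. p $ i + wind net $ i - demand net $ i) = (\<Sum>i\<in>UNIV. (laplacian net *v \<theta>) $ i)"
    using assms(2) by (simp add: dc_flow_def x)
  also have "\<dots> = (\<Sum>j\<in>UNIV. (\<Sum>i\<in>UNIV. laplacian net $ i $ j) * \<theta> $ j)"
    by (simp only: matrix_vector_mult_def vec_lambda_beta sum_distrib_right) (rule sum.swap)
  also have "\<dots> = 0" by (simp add: laplacian_column_sum[OF assms(1)])
  finally show ?thesis by (simp add: power_balance_def x)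
qed

text \<open>Moving the matrix to the other side of the inner product applies it to \<open>w\<close>,
  which yields \<open>w - (ones \<bullet> w) *\<^sub>R \<alpha>\<close>. The general scalar
  \<open>c\<close> covers both flow directions, where it is plus or minus the susceptance.\<close>

lemma line_a_vec_inner:
  "((c *\<^sub>R (row i B - row j B)) v* (mat 1 - (\<chi> k l. \<alpha> $ k * ones $ l))) \<bullet> w
    = c * ((B *v (w - (ones \<bullet> w) *\<^sub>R \<alpha>)) $ i - (B *v (w - (ones \<bullet> w) *\<^sub>R \<alpha>)) $ j)"
proof -
  have "(\<chi> k l. \<alpha> $ k * ones $ l) *v w = (ones \<bullet> w) *\<^sub>R \<alpha>"
    by (simp add: matrix_vector_mult_def inner_vec_def vec_eq_iff sum_distrib_left[symmetric] mult.commute)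
  then show ?thesis
    unfolding dot_lmul_matrix
    by (simp add: matrix_vector_mult_diff_rdistrib inner_diff_left row_def matrix_vector_mul_component)
qed

text \<open>These pointwise equivalences identify the events bounded through \<open>a_vec\<close>
  and \<open>b_val\<close> with the line and generator events of CC-OPF.\<close>

lemma chance_constraint_iff:
  "a_vec net x (Line_Upper i j) \<bullet> w \<le> b_val net x (Line_Upper i j) \<longleftrightarrow> line_flow net x i j w \<le> fmax net i j"
  "a_vec net x (Line_Lower i j) \<bullet> w \<le> b_val net x (Line_Lower i j) \<longleftrightarrow> line_flow net x i j w \<ge> - fmax net i j"
  "a_vec net x (Gen_Lower i) \<bullet> w \<le> b_val net x (Gen_Lower i) \<longleftrightarrow> gen_output x i w \<ge> pmin net i"
  "a_vec net x (Gen_Upper i) \<bullet> w \<le> b_val net x (Gen_Upper i) \<longleftrightarrow> gen_output x i w \<le> pmax net i"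
  by (cases x; simp only: a_vec.simps b_val.simps line_a_vec_inner;
      auto simp: line_flow_def gen_output_def algebra_simps)+

theorem mainTheorem2:
  fixes net :: "('v::finite) network"
    and M :: "'a measure"
    and \<omega> :: "'a \<Rightarrow> real^'v"
    and mix :: "('v, 'j) mixture"
    and Cov :: "real^'v^'v"
    and D :: approx_data
    and p \<theta> \<alpha> :: "real^'v"
    and u :: "'v chance_index \<Rightarrow> 'j aux_vars"
  assumes "valid_network net"
    and "prob_space M"
    and "valid_mixture mix"
    and "distributed M lborel \<omega> (\<lambda>w. ennreal (mixture_density mix w))"
    and "(LINT \<xi>|M. \<omega> \<xi>) = 0"
    and "covariance_matrix M \<omega> = Cov"
    and "valid_approx D"
    and "((p, \<theta>, \<alpha>), u) \<in> feasible (cc_opf_2 net mix Cov D)"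
  shows "(p, \<theta>, \<alpha>) \<in> feasible (cc_opf net M \<omega>)"
proof -
  let ?x = "(p, \<theta>, \<alpha>)"
  have x: "?x \<in> decision_domain net" "participation net ?x" "dc_flow net ?x"
    and chance: "\<And>m. m \<in> chance_indices net \<Longrightarrow>
      approx_chance D mix (risk net) (a_vec net ?x m) (b_val net ?x m) (u m)"
    using assms(8) by (auto simp: cc_opf_2_def)
  have "0 \<le> risk net" using assms(1) by (simp add: valid_network_def)
  have prob: "1 - risk net \<le> \<P>(\<xi> in M. a_vec net ?x m \<bullet> \<omega> \<xi> \<le> b_val net ?x m)" if "m \<in> chance_indices net" for m
    by (rule approx_chance_safe[OF assms(2-4) assms(7) \<open>0 \<le> risk net\<close> chance[OF that]])
  have "Line_Upper i j \<in> chance_indices net" "Line_Lower i j \<in> chance_indices net"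
    if "(i, j) \<in> branches net" for i j
    using that by (force simp: chance_indices_def)+
  note line = this[THEN prob, unfolded chance_constraint_iff]
  have "Gen_Lower i \<in> chance_indices net" "Gen_Upper i \<in> chance_indices net"
    if "i \<in> gens net" for i
    using that by (auto simp: chance_indices_def)
  note gen = this[THEN prob, unfolded chance_constraint_iff]
  show ?thesis
    unfolding cc_opf_def
    using x dc_flow_imp_power_balance[OF assms(1) x(3)] line gen by auto
qed

end
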